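(* Let $(X,\mathcal{S}(X),\mu)$ be a standard probability space equipped with a measurable metric $d$. Suppose $(X,d)$ is compact, $\mu$ is nonatomic, and $d$ is $\mu$-compatible and $\mu$-regular. Let $T$ be a measure-preserving transformation on $X$. If $T$ is restricted pairwise sensitive with asymptotic rate $a>0$, then $h_\mu(T)\ge\frac{1}{a}$, where $h_\mu(T)$ is the metric (measure-theoretic) entropy of $T$.
   Context: The metric $d$ on $X$ is assumed measurable, so that $d$-balls are measurable. $B_r(x)=\{y: d(x,y)<r\}$ is the open ball and $\overline{B_r}(x)=\{y:d(x,y)\le r\}$ the closed ball. $\log$ is the natural logarithm (also in the definition of entropy), and $\mathbb{N}_0=\{0,1,2,\ldots\}$. $d$ is $\mu$-compatible if all nonempty open $d$-balls have positive $\mu$-measure. $d$ is $\mu$-regular if for every $x\in X$ there exists $c>0$ such that $c\,\mu(\overline{B_r}(x))\le \mu(B_r(x))$ for all $r>0$. $T$ is restricted pairwise sensitive with asymptotic rate $a>0$ if there exists $\delta>0$ such that for $\mu\otimes\mu$-a.e. $(x,y)\in X\times X$ there exists $n\in\mathbb{N}_0$ with $n\le -a\log\mu(B_{d(x,y)}(x))$ and $d(T^nx,T^ny)>\delta$ (with the convention $-\log 0=+\infty$). *)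

theory Defs
  imports "HOL-Analysis.Analysis" "HOL-Probability.Probability" "HOL-Library.Disjoint_Sets"
begin

definition measure_isomorphism :: "'a measure \<Rightarrow> 'b measure \<Rightarrow> ('a \<Rightarrow> 'b) \<Rightarrow> bool" where
  "measure_isomorphism M N f \<longleftrightarrow>
     f \<in> measurable M N \<and> bij_betw f (space M) (space N) \<and>
     the_inv_into (space M) f \<in> measurable N M \<and> distr M N f = N"

definition isomorphic_mod_0 :: "'a measure \<Rightarrow> 'b measure \<Rightarrow> bool" where
  "isomorphic_mod_0 M N \<longleftrightarrow>
     (\<exists>A\<in>null_sets M. \<exists>B\<in>null_sets N. \<exists>f.
        measure_isomorphism (restrict_space M (space M - A)) (restrict_space N (space N - B)) f)"

text \<open>
  Standardness is understood up to null sets and up to completion: the completed space is isomorphic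
  mod 0 to a completed Borel probability measure on the line.  Thus both probability
  measures on standard Borel spaces and Lebesgue--Rokhlin spaces, which are complete, are
  standard.
\<close>

definition standard_prob_space :: "'a measure \<Rightarrow> bool" where
  "standard_prob_space M \<longleftrightarrow>
     prob_space M \<and>
     (\<exists>N :: real measure. prob_space N \<and> sets N = sets borel \<and>
        isomorphic_mod_0 (completion M) (completion N))"

definition nonatomic :: "'a measure \<Rightarrow> bool" where
  "nonatomic M \<longleftrightarrow>
     (\<forall>A\<in>sets M. 0 < emeasure M A \<longrightarrow>
        (\<exists>B\<in>sets M. B \<subseteq> A \<and> 0 < emeasure M B \<and> emeasure M B < emeasure M A))"

definition measure_preserving :: "'a measure \<Rightarrow> ('a \<Rightarrow> 'a) \<Rightarrow> bool" where
  "measure_preserving M T \<longleftrightarrow>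
     T \<in> measurable M M \<and> (\<forall>A\<in>sets M. emeasure M (T -` A \<inter> space M) = emeasure M A)"


subsection \<open>Metrics on a measure space\<close>

definition measurable_metric :: "'a measure \<Rightarrow> ('a \<Rightarrow> 'a \<Rightarrow> real) \<Rightarrow> bool" where
  "measurable_metric M d \<longleftrightarrow>
     Metric_space (space M) d \<and> (\<lambda>(x, y). d x y) \<in> borel_measurable (M \<Otimes>\<^sub>M M)"

definition compatible_metric :: "'a measure \<Rightarrow> ('a \<Rightarrow> 'a \<Rightarrow> real) \<Rightarrow> bool" where
  "compatible_metric M d \<longleftrightarrow>
     (\<forall>x\<in>space M. \<forall>r. Metric_space.mball (space M) d x r \<noteq> {} \<longrightarrow>
        0 < measure M (Metric_space.mball (space M) d x r))"

definition regular_metric :: "'a measure \<Rightarrow> ('a \<Rightarrow> 'a \<Rightarrow> real) \<Rightarrow> bool" where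
  "regular_metric M d \<longleftrightarrow>
     (\<forall>x\<in>space M. \<exists>c>0. \<forall>r>0.
        c * measure M (Metric_space.mcball (space M) d x r)
          \<le> measure M (Metric_space.mball (space M) d x r))"

text \<open>The convention $-\log 0 = +\infty$ is needed, since \<open>ln 0 = 0\<close> in the library.\<close>

definition neg_log :: "real \<Rightarrow> ereal" where
  "neg_log p = (if p = 0 then \<infinity> else ereal (- ln p))"

definition restricted_pairwise_sensitive ::
    "'a measure \<Rightarrow> ('a \<Rightarrow> 'a \<Rightarrow> real) \<Rightarrow> ('a \<Rightarrow> 'a) \<Rightarrow> real \<Rightarrow> bool" where
  "restricted_pairwise_sensitive M d T a \<longleftrightarrow>
     (\<exists>\<delta>>0. AE (x, y) in M \<Otimes>\<^sub>M M. \<exists>n::nat.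
        ereal (real n) \<le> ereal a * neg_log (measure M (Metric_space.mball (space M) d x (d x y))) \<and>
        d ((T ^^ n) x) ((T ^^ n) y) > \<delta>)"


subsection \<open>Measure-theoretic entropy\<close>

definition finite_partition :: "'a measure \<Rightarrow> 'a set set \<Rightarrow> bool" where
  "finite_partition M P \<longleftrightarrow> finite P \<and> P \<subseteq> sets M \<and> partition_on (space M) P"

text \<open>The convention \<open>0 * log 0 = 0\<close> holds automatically.\<close>

definition partition_entropy :: "'a measure \<Rightarrow> 'a set set \<Rightarrow> real" where
  "partition_entropy M P = - (\<Sum>A\<in>P. measure M A * ln (measure M A))"

text \<open>Empty preimages are discarded, as \<^const>\<open>partition_on\<close> excludes empty cells.\<close>

definition preimage_partition :: "'a measure \<Rightarrow> ('a \<Rightarrow> 'a) \<Rightarrow> 'a set set \<Rightarrow> 'a set set" where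
  "preimage_partition M S P = (\<lambda>A. S -` A \<inter> space M) ` P - {{}}"

text \<open>
  The join of $P, T^{-1}P, \dots, T^{-(n-1)}P$.  The value at \<open>n = 0\<close> is irrelevant,
  as only the limit in \<open>n\<close> is used below.
\<close>

definition iterated_join :: "'a measure \<Rightarrow> ('a \<Rightarrow> 'a) \<Rightarrow> 'a set set \<Rightarrow> nat \<Rightarrow> 'a set set" where
  "iterated_join M T P n = common_refinement ((\<lambda>i. preimage_partition M (T ^^ i) P) ` {..<n})"

definition entropy_wrt_partition :: "'a measure \<Rightarrow> ('a \<Rightarrow> 'a) \<Rightarrow> 'a set set \<Rightarrow> real" where
  "entropy_wrt_partition M T P =
     lim (\<lambda>n. partition_entropy M (iterated_join M T P n) / real n)"

definition metric_entropy :: "'a measure \<Rightarrow> ('a \<Rightarrow> 'a) \<Rightarrow> ereal" where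
  "metric_entropy M T =
     (SUP P\<in>{P. finite_partition M P}. ereal (entropy_wrt_partition M T P))"

end

theory Submission
  imports Defs
begin

text \<open>
  Let \<open>\<delta>\<close> be the sensitivity constant, and choose a finite partition \<open>P\<close> such that any two
  points of a cell are at distance less than \<open>\<delta>\<close>; compactness provides it.  Write \<open>P\<^sub>n(x)\<close> for the cell of \<open>x\<close> in the join
  of \<open>P, T\<^bsup>-1\<^esup>P, \<dots>, T\<^bsup>-(n-1)\<^esup>P\<close>.  A point \<open>y\<close> of \<open>P\<^sub>n(x)\<close> stays \<open>\<delta>\<close>-close to \<open>x\<close> up to time
  \<open>n - 1\<close>, so the time \<open>m\<close> at which sensitivity separates the two points is at least \<open>n\<close>.  The bound
  \<open>m \<le> - a log \<mu>(B\<^bsub>d(x,y)\<^esub>(x))\<close> therefore says that, for almost every \<open>x\<close> and almost every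
  \<open>y \<in> P\<^sub>n(x)\<close>, the ball around \<open>x\<close> that just misses \<open>y\<close> has measure at most \<open>exp (- n / a)\<close>.

  The radii of such balls have a supremum \<open>r\<close>.  The open ball of radius \<open>r\<close> is an increasing union
  of balls of measure at most \<open>exp (- n / a)\<close>, hence satisfies the same bound, while \<open>P\<^sub>n(x)\<close> is
  contained mod 0 in the closed ball.  Regularity at \<open>x\<close> compares the two, and so
  \<open>c(x) \<mu>(P\<^sub>n(x)) \<le> exp (- n / a)\<close> with \<open>c(x) > 0\<close> independent of \<open>n\<close>
  (\<open>measure_le_of_ball_measures_le\<close>).

  A pointwise exponential decay of the measures of cells bounds the entropy from below
  (\<open>entropy_ge_local_decay_rate\<close>).  The Shannon--McMillan--Breiman theorem would give this at once,
  but only its elementary half is involved: on a set \<open>E\<^sub>k\<close> containing almost every \<open>x\<close> with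
  \<open>1 / c(x) \<le> k + 1\<close> the information function \<open>- log \<mu>(P\<^sub>n(x))\<close> is at least \<open>n / a - log (k + 1)\<close>,
  and it is nonnegative elsewhere.
  Integrating, dividing by \<open>n\<close> and letting \<open>n \<rightarrow> \<infinity>\<close> gives \<open>h(T, P) \<ge> \<mu>(E\<^sub>k) / a\<close>, and
  \<open>\<mu>(E\<^sub>k) \<rightarrow> 1\<close>.

  The entropy of a partition is the value of \<open>lim\<close>, which carries information only for a convergent
  sequence.  Convergence is Fekete's lemma (\<open>subadditive_convergent_average\<close>) applied to the
  subadditivity of entropy under joins (\<open>partition_entropy_join_le\<close>).
\<close>

section \<open>Subadditive sequences\<close>

text \<open>
  Fekete's lemma.  Fix \<open>N\<close> with \<open>u N / N\<close> close to the infimum of the averages; cutting \<open>n\<close> into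
  blocks of length \<open>N\<close> and a bounded remainder makes every later average nearly as small.
\<close>

lemma subadditive_convergent_average:
  fixes u :: "nat \<Rightarrow> real"
  assumes nonneg: "\<And>n. 0 \<le> u n"
    and subadd: "\<And>m n. 0 < m \<Longrightarrow> 0 < n \<Longrightarrow> u (m + n) \<le> u m + u n"
  shows "convergent (\<lambda>n. u n / real n)"
proof -
  define L where "L = (INF n\<in>{1..}. u n / real n)"
  have bdd: "bdd_below ((\<lambda>n. u n / real n) ` {1..})"
    by (intro bdd_belowI[of _ 0]) (auto simp: nonneg)
  have lower: "L \<le> u n / real n" if "0 < n" for n
    unfolding L_def by (rule cINF_lower[OF bdd]) (use that in auto)
  have multiple: "u (q * N + r) \<le> real q * u N + u r" if "0 < N" "0 < r" for q N r
  proof (induction q)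
    case (Suc q)
    have "u (Suc q * N + r) = u (N + (q * N + r))" by (simp add: ac_simps)
    also have "\<dots> \<le> u N + u (q * N + r)" using that by (intro subadd) auto
    finally show ?case using Suc by (simp add: algebra_simps)
  qed simp
  have "(\<lambda>n. u n / real n) \<longlonglongrightarrow> L"
  proof (rule tendstoI)
    fix e :: real assume "0 < e"
    then have "(INF n\<in>{1..}. u n / real n) < L + e / 2" by (simp add: L_def)
    then have "\<exists>N\<in>{1..}. u N / real N < L + e / 2"
      by (subst (asm) cINF_less_iff[OF _ bdd]) simp_all
    then obtain N where N: "0 < N" "u N / real N < L + e / 2"
      by (auto simp: Suc_le_eq)
    define C where "C = Max (u ` {1..N})"
    have upper: "u n / real n \<le> u N / real N + C / real n" if "0 < n" for n
    proof -
      \<comment> \<open>Dividing \<open>n - 1\<close> rather than \<open>n\<close> keeps the remainder positive, as \<open>subadd\<close> requires.\<close>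
      define q r where "q = (n - 1) div N" and "r = (n - 1) mod N + 1"
      have n: "n = q * N + r" using that by (simp add: q_def r_def)
      have r: "r \<in> {1..N}" using N(1) by (simp add: r_def Suc_leI)
      have "u r \<le> C" unfolding C_def using r by (intro Max_ge) auto
      moreover have "u n \<le> real q * u N + u r"
        unfolding n using r N(1) by (intro multiple) auto
      moreover have "real q * u N \<le> real n * (u N / real N)"
      proof -
        have "real q * real N \<le> real n" unfolding n by simp
        then have "real q * real N * (u N / real N) \<le> real n * (u N / real N)"
          by (intro mult_right_mono) (simp_all add: nonneg)
        then show ?thesis using N(1) by simp
      qed
      ultimately have "u n \<le> real n * (u N / real N) + C" by linarith
      then have "u n / real n \<le> (real n * (u N / real N) + C) / real n"
        by (intro divide_right_mono) auto
      then show ?thesis using that by (simp add: add_divide_distrib)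
    qed
    have "\<forall>\<^sub>F n in sequentially. C / real n < e / 2"
      using order_tendstoD(2)[OF lim_const_over_n[of C], of "e / 2"] \<open>0 < e\<close> by simp
    then show "\<forall>\<^sub>F n in sequentially. dist (u n / real n) L < e"
      using eventually_gt_at_top[of 0]
    proof eventually_elim
      case (elim n)
      then have "u n / real n < L + e" using upper[of n] N(2) by linarith
      then show ?case using lower[of n] elim by (simp add: dist_real_def)
    qed
  qed
  then show ?thesis by (auto simp: convergent_def)
qed

section \<open>Partitions as equivalence relations\<close>

text \<open>
  Partitions are sets of sets here, and a cell of a join has many representations as an intersection.
  The relation of lying in a common cell determines the partition and turns joins into conjunctions
  and preimages into substitutions, which makes identities between joins easy to verify.
\<close>
definition same_cell :: "'a set set \<Rightarrow> 'a \<Rightarrow> 'a \<Rightarrow> bool" where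
  "same_cell P x y \<longleftrightarrow> (\<exists>A\<in>P. x \<in> A \<and> y \<in> A)"

lemma partition_on_eqI:
  assumes P: "partition_on X P" and Q: "partition_on X Q"
    and same: "\<And>x y. x \<in> X \<Longrightarrow> y \<in> X \<Longrightarrow> same_cell P x y \<longleftrightarrow> same_cell Q x y"
  shows "P = Q"
proof -
  have P_in: "x \<in> X \<and> y \<in> X" if "same_cell P x y" for x y
    using that partition_onD1[OF P] by (auto simp: same_cell_def)
  have Q_in: "x \<in> X \<and> y \<in> X" if "same_cell Q x y" for x y
    using that partition_onD1[OF Q] by (auto simp: same_cell_def)
  have eq: "same_cell P x y \<longleftrightarrow> same_cell Q x y" for x y
    using P_in[of x y] Q_in[of x y] same[of x y] by argo
  have "{(x, y). \<exists>A\<in>P. x \<in> A \<and> y \<in> A} = {(x, y). \<exists>A\<in>Q. x \<in> A \<and> y \<in> A}"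
    by (simp only: eq[unfolded same_cell_def])
  then have "X // {(x, y). \<exists>A\<in>P. x \<in> A \<and> y \<in> A} = X // {(x, y). \<exists>A\<in>Q. x \<in> A \<and> y \<in> A}"
    by (rule arg_cong)
  then show ?thesis
    unfolding partition_on_eq_quotient[OF P] partition_on_eq_quotient[OF Q] .
qed

lemma same_cell_common_refinement:
  "same_cell (common_refinement \<P>) x y \<longleftrightarrow> (\<forall>P\<in>\<P>. same_cell P x y)"
proof
  assume "\<forall>P\<in>\<P>. same_cell P x y"
  then obtain f where f: "\<And>P. P \<in> \<P> \<Longrightarrow> f P \<in> P \<and> x \<in> f P \<and> y \<in> f P"
    unfolding same_cell_def by metis
  have "f \<in> (\<Pi> P\<in>\<P>. P)" using f by blast
  moreover have "x \<in> \<Inter> (f ` \<P>)" using f by blast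
  ultimately have "\<Inter> (f ` \<P>) \<in> common_refinement \<P>"
    unfolding common_refinement by blast
  moreover have "y \<in> \<Inter> (f ` \<P>)" using f by blast
  ultimately show "same_cell (common_refinement \<P>) x y"
    unfolding same_cell_def using \<open>x \<in> \<Inter> (f ` \<P>)\<close> by blast
next
  assume "same_cell (common_refinement \<P>) x y"
  then obtain A where A: "A \<in> common_refinement \<P>" "x \<in> A" "y \<in> A"
    by (auto simp: same_cell_def)
  show "\<forall>P\<in>\<P>. same_cell P x y"
  proof
    fix P assume "P \<in> \<P>"
    then obtain B where "B \<in> P" "A \<subseteq> B" using common_refinement_exists[OF A(1)] by blast
    then show "same_cell P x y" using A by (auto simp: same_cell_def)
  qed
qed

lemma same_cell_preimage_partition:
  assumes "x \<in> space M" "y \<in> space M"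
  shows "same_cell (preimage_partition M S P) x y \<longleftrightarrow> same_cell P (S x) (S y)"
proof
  assume "same_cell P (S x) (S y)"
  then obtain A where A: "A \<in> P" "S x \<in> A" "S y \<in> A"
    by (auto simp: same_cell_def)
  have "x \<in> S -` A \<inter> space M" "y \<in> S -` A \<inter> space M" using assms A by simp_all
  moreover from this have "S -` A \<inter> space M \<in> preimage_partition M S P"
    unfolding preimage_partition_def by (intro DiffI imageI A) force
  ultimately show "same_cell (preimage_partition M S P) x y"
    unfolding same_cell_def by (intro bexI conjI)
next
  assume "same_cell (preimage_partition M S P) x y"
  then obtain B where "B \<in> preimage_partition M S P" "x \<in> B" "y \<in> B"
    unfolding same_cell_def by (elim bexE conjE)
  then obtain A where "A \<in> P" "x \<in> S -` A" "y \<in> S -` A"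
    unfolding preimage_partition_def by (elim DiffE imageE) simp
  then show "same_cell P (S x) (S y)" by (auto simp: same_cell_def)
qed

lemma same_cell_iterated_join:
  assumes "x \<in> space M" "y \<in> space M"
  shows "same_cell (iterated_join M T P n) x y \<longleftrightarrow>
    (\<forall>i<n. same_cell P ((T ^^ i) x) ((T ^^ i) y))"
  using assms
  by (simp add: iterated_join_def same_cell_common_refinement same_cell_preimage_partition
      lessThan_def)

definition partition_join :: "'a set set \<Rightarrow> 'a set set \<Rightarrow> 'a set set" where
  "partition_join P Q = (\<lambda>(A, B). A \<inter> B) ` (P \<times> Q) - {{}}"

lemma same_cell_partition_join:
  "same_cell (partition_join P Q) x y \<longleftrightarrow> same_cell P x y \<and> same_cell Q x y"
proof
  assume "same_cell P x y \<and> same_cell Q x y"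
  then obtain A B where "(A, B) \<in> P \<times> Q" "x \<in> A \<inter> B" "y \<in> A \<inter> B"
    by (auto simp: same_cell_def)
  moreover from this have "A \<inter> B \<in> partition_join P Q"
    unfolding partition_join_def by (intro DiffI image_eqI[of _ _ "(A, B)"]) auto
  ultimately show "same_cell (partition_join P Q) x y"
    unfolding same_cell_def by (intro bexI[of _ "A \<inter> B"] conjI)
next
  assume "same_cell (partition_join P Q) x y"
  then obtain C where "C \<in> partition_join P Q" "x \<in> C" "y \<in> C"
    unfolding same_cell_def by (elim bexE conjE)
  then obtain A B where "A \<in> P" "B \<in> Q" "x \<in> A \<inter> B" "y \<in> A \<inter> B"
    unfolding partition_join_def by (elim DiffE imageE SigmaE) simp
  then show "same_cell P x y \<and> same_cell Q x y" by (auto simp: same_cell_def)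
qed

lemma Union_eq_same_cell: "\<Union>P = {x. same_cell P x x}"
  by (auto simp: same_cell_def)

lemma finite_partition_disjoint:
  assumes "finite_partition M P" "A \<in> P" "B \<in> P" "A \<noteq> B"
  shows "A \<inter> B = {}"
  using assms by (auto simp: finite_partition_def partition_on_def disjoint_def)

lemma finite_partition_join:
  assumes P: "finite_partition M P" and Q: "finite_partition M Q"
  shows "finite_partition M (partition_join P Q)"
proof -
  have "partition_on (space M) (partition_join P Q)"
  proof (rule partition_onI)
    have "\<Union> (partition_join P Q) = \<Union>P \<inter> \<Union>Q"
      unfolding Union_eq_same_cell by (auto simp: same_cell_partition_join)
    then show "\<Union> (partition_join P Q) = space M"
      using P Q by (simp add: finite_partition_def partition_on_def)
    fix p q assume "p \<in> partition_join P Q" "q \<in> partition_join P Q" and ne: "p \<noteq> q"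
    then obtain A B A' B' where pq: "p = A \<inter> B" "q = A' \<inter> B'"
        and in_PQ: "A \<in> P" "B \<in> Q" "A' \<in> P" "B' \<in> Q"
      by (auto simp: partition_join_def)
    then have "A \<noteq> A' \<or> B \<noteq> B'" using ne by blast
    then have "A \<inter> A' = {} \<or> B \<inter> B' = {}"
      using finite_partition_disjoint[OF P] finite_partition_disjoint[OF Q] in_PQ by metis
    then show "disjnt p q" unfolding pq disjnt_def by blast
  qed (simp add: partition_join_def)
  then show ?thesis
    using P Q by (auto simp: finite_partition_def partition_join_def)
qed

lemma finite_partition_preimage:
  assumes P: "finite_partition M P" and S: "S \<in> measurable M M"
  shows "finite_partition M (preimage_partition M S P)"
proof -
  have "partition_on (space M) (preimage_partition M S P)"
  proof (rule partition_onI)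
    have "\<Union> (preimage_partition M S P) = S -` \<Union>P \<inter> space M"
      by (auto simp: preimage_partition_def)
    also have "\<dots> = space M"
      using P measurable_space[OF S] by (auto simp: finite_partition_def partition_on_def)
    finally show "\<Union> (preimage_partition M S P) = space M" .
    fix p q assume "p \<in> preimage_partition M S P" "q \<in> preimage_partition M S P" and ne: "p \<noteq> q"
    then obtain A B where pq: "p = S -` A \<inter> space M" "q = S -` B \<inter> space M" "A \<in> P" "B \<in> P"
      by (auto simp: preimage_partition_def)
    then have "A \<inter> B = {}" using ne finite_partition_disjoint[OF P] by metis
    then show "disjnt p q" unfolding pq disjnt_def by blast
  qed (simp add: preimage_partition_def)
  then show ?thesis
    using P measurable_sets[OF S] by (auto simp: finite_partition_def preimage_partition_def)
qed

lemma measurable_funpow: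
  assumes "T \<in> measurable M M"
  shows "(T ^^ n) \<in> measurable M M"
proof (induction n)
  case (Suc n)
  then show ?case using measurable_comp[OF Suc assms] by (simp only: funpow.simps)
qed (simp add: id_def)

lemma measure_preserving_funpow:
  assumes T: "measure_preserving M T"
  shows "measure_preserving M (T ^^ n)"
proof (induction n)
  case 0
  have "A \<inter> space M = A" if "A \<in> sets M" for A
    using sets.sets_into_space[OF that] by blast
  then show ?case by (simp add: measure_preserving_def id_def)
next
  case (Suc n)
  have Tm: "T \<in> measurable M M" using T by (simp add: measure_preserving_def)
  have "emeasure M ((T ^^ Suc n) -` A \<inter> space M) = emeasure M A" if A: "A \<in> sets M" for A
  proof -
    have "(T ^^ Suc n) -` A \<inter> space M = (T ^^ n) -` (T -` A \<inter> space M) \<inter> space M"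
      using measurable_space[OF measurable_funpow[OF Tm]] by auto
    moreover have "emeasure M ((T ^^ n) -` (T -` A \<inter> space M) \<inter> space M) = emeasure M (T -` A \<inter> space M)"
      using Suc measurable_sets[OF Tm A] unfolding measure_preserving_def by blast
    moreover have "emeasure M (T -` A \<inter> space M) = emeasure M A"
      using T A unfolding measure_preserving_def by blast
    ultimately show ?thesis by argo
  qed
  then show ?case using measurable_funpow[OF Tm] unfolding measure_preserving_def by blast
qed

lemma finite_partition_iterated_join:
  assumes P: "finite_partition M P" and T: "T \<in> measurable M M" and n: "0 < n"
  shows "finite_partition M (iterated_join M T P n)"
proof -
  define \<P> where "\<P> = (\<lambda>i. preimage_partition M (T ^^ i) P) ` {..<n}"
  have part: "finite_partition M Q" if "Q \<in> \<P>" for Q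
    using that finite_partition_preimage[OF P measurable_funpow[OF T]] by (auto simp: \<P>_def)
  have ne: "\<P> \<noteq> {}" "finite \<P>" using n by (auto simp: \<P>_def)
  have "common_refinement \<P> \<subseteq> sets M"
  proof
    fix A assume "A \<in> common_refinement \<P>"
    then obtain f where f: "f \<in> (\<Pi> P\<in>\<P>. P)" "A = \<Inter> (f ` \<P>)"
      by (auto simp: common_refinement)
    have "f Q \<in> sets M" if "Q \<in> \<P>" for Q
      using part[OF that] f(1) that by (auto simp: finite_partition_def)
    then show "A \<in> sets M"
      unfolding f(2) using ne by (intro sets.finite_INT) auto
  qed
  moreover have "finite (common_refinement \<P>)"
    using ne part by (intro finite_common_refinement) (auto simp: finite_partition_def)
  moreover have "partition_on (space M) (common_refinement \<P>)"
    using ne part by (intro partition_on_common_refinement) (auto simp: finite_partition_def)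
  ultimately show ?thesis by (simp add: finite_partition_def iterated_join_def \<P>_def)
qed

text \<open>
  Agreement of two itineraries up to time \<open>m + n\<close> splits at time \<open>m\<close>.  This is what makes the
  entropies of the iterated joins subadditive in the time.
\<close>
lemma iterated_join_add:
  assumes P: "finite_partition M P" and T: "T \<in> measurable M M" and m: "0 < m" and n: "0 < n"
  shows "iterated_join M T P (m + n) =
    partition_join (iterated_join M T P m) (preimage_partition M (T ^^ m) (iterated_join M T P n))"
    (is "?L = ?R")
proof (rule partition_on_eqI)
  have "finite_partition M ?L" "finite_partition M ?R"
    using assms by (auto intro!: finite_partition_iterated_join finite_partition_join
      finite_partition_preimage measurable_funpow)
  then show "partition_on (space M) ?L" "partition_on (space M) ?R"
    by (auto simp: finite_partition_def)
  fix x y assume xy: "x \<in> space M" "y \<in> space M"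
  have Tm: "(T ^^ m) x \<in> space M" "(T ^^ m) y \<in> space M"
    using xy measurable_space[OF measurable_funpow[OF T]] by auto
  have split: "(\<forall>i<m + n. Q i) \<longleftrightarrow> (\<forall>i<m. Q i) \<and> (\<forall>j<n. Q (j + m))" for Q
  proof (intro iffI conjI allI impI)
    fix i assume *: "(\<forall>i<m. Q i) \<and> (\<forall>j<n. Q (j + m))" "i < m + n"
    show "Q i"
    proof (cases "i < m")
      case False
      then have "i - m < n" "i = (i - m) + m" using *(2) by auto
      then show ?thesis using *(1) by metis
    qed (use * in blast)
  qed auto
  show "same_cell ?L x y \<longleftrightarrow> same_cell ?R x y"
    by (simp add: same_cell_partition_join same_cell_preimage_partition same_cell_iterated_join
      xy Tm split funpow_add)
qed

section \<open>Entropy of finite partitions\<close>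

text \<open>
  Preimage partitions and joins are images of an index set with the empty set removed.  Coinciding
  cells can only be empty, so sums over cells may be taken over indices.
\<close>
lemma sum_nonempty_image:
  fixes h :: "'b set \<Rightarrow> real"
  assumes "finite I" and "h {} = 0"
    and disj: "\<And>i j. i \<in> I \<Longrightarrow> j \<in> I \<Longrightarrow> i \<noteq> j \<Longrightarrow> g i \<inter> g j = {}"
  shows "sum h (g ` I - {{}}) = (\<Sum>i\<in>I. h (g i))"
proof -
  have "sum h (g ` I - {{}}) = sum h (g ` I)"
    using assms by (intro sum.mono_neutral_left) auto
  also have "\<dots> = (\<Sum>i\<in>I. h (g i))"
  proof (rule sum.reindex_nontrivial[OF assms(1), unfolded o_def])
    fix i j assume "i \<in> I" "j \<in> I" "i \<noteq> j" "g i = g j"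
    then have "g i = {}" using disj[of i j] by simp
    then show "h (g i) = 0" using assms(2) by simp
  qed
  finally show ?thesis .
qed

lemma partition_entropy_preimage:
  assumes S: "measure_preserving M S" and P: "finite_partition M P"
  shows "partition_entropy M (preimage_partition M S P) = partition_entropy M P"
proof -
  have meas: "measure M (S -` A \<inter> space M) = measure M A" if "A \<in> P" for A
    using that S P by (auto simp: measure_preserving_def finite_partition_def measure_def)
  have "(\<Sum>A\<in>preimage_partition M S P. measure M A * ln (measure M A)) =
    (\<Sum>A\<in>P. measure M (S -` A \<inter> space M) * ln (measure M (S -` A \<inter> space M)))"
    unfolding preimage_partition_def using P finite_partition_disjoint[OF P]
    by (intro sum_nonempty_image) (auto simp: finite_partition_def)
  also have "\<dots> = (\<Sum>A\<in>P. measure M A * ln (measure M A))"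
    by (intro sum.cong) (auto simp: meas)
  finally show ?thesis by (simp add: partition_entropy_def)
qed

context prob_space
begin

lemma sum_prob_partition:
  assumes P: "finite_partition M P" and B: "B \<in> sets M"
  shows "(\<Sum>A\<in>P. prob (A \<inter> B)) = prob B"
proof -
  have "(\<Sum>A\<in>P. prob (A \<inter> B)) = prob (\<Union>A\<in>P. A \<inter> B)"
    using P B finite_partition_disjoint[OF P]
    by (intro finite_measure_finite_Union[symmetric])
      (auto simp: finite_partition_def disjoint_family_on_def)
  also have "(\<Union>A\<in>P. A \<inter> B) = B"
    using P sets.sets_into_space[OF B] by (auto simp: finite_partition_def partition_on_def)
  finally show ?thesis .
qed

lemma partition_entropy_nonneg: "0 \<le> partition_entropy M P"
proof -
  have "prob A * ln (prob A) \<le> 0" for A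
  proof (cases "prob A = 0")
    case False
    then have "ln (prob A) \<le> 0"
      by (simp add: ln_le_zero_iff zero_less_measure_iff)
    then show ?thesis by (simp add: mult_nonneg_nonpos)
  qed simp
  then show ?thesis by (simp add: partition_entropy_def sum_nonpos)
qed

text \<open>
  Mutual information is nonnegative: the relative entropy of the joint distribution with respect to
  the product of its marginals is estimated termwise by \<open>ln x \<le> x - 1\<close>, and the resulting bounds
  sum to \<open>0\<close> since both distributions have total mass \<open>1\<close>.
\<close>
lemma partition_entropy_join_le:
  assumes P: "finite_partition M P" and Q: "finite_partition M Q"
  shows "partition_entropy M (partition_join P Q) \<le> partition_entropy M P + partition_entropy M Q"
proof -
  have fin: "finite P" "finite Q" and sets: "\<And>A. A \<in> P \<Longrightarrow> A \<in> events" "\<And>A. A \<in> Q \<Longrightarrow> A \<in> events"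
    using P Q by (auto simp: finite_partition_def)
  have marginal_P: "(\<Sum>B\<in>Q. prob (A \<inter> B)) = prob A" if "A \<in> P" for A
    using sum_prob_partition[OF Q sets(1)[OF that]] by (simp add: Int_commute)
  have marginal_Q: "(\<Sum>A\<in>P. prob (A \<inter> B)) = prob B" if "B \<in> Q" for B
    using sum_prob_partition[OF P sets(2)[OF that]] .
  have total: "(\<Sum>A\<in>P. prob A) = 1" "(\<Sum>B\<in>Q. prob B) = 1"
    using sum_prob_partition[OF P sets.top] sum_prob_partition[OF Q sets.top] sets
    by (simp_all add: prob_space)
  have gibbs: "prob (A \<inter> B) * ln (prob A) + prob (A \<inter> B) * ln (prob B)
      - prob (A \<inter> B) * ln (prob (A \<inter> B)) \<le> prob A * prob B - prob (A \<inter> B)"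
    if AB: "A \<in> P" "B \<in> Q" for A B
  proof (cases "prob (A \<inter> B) = 0")
    case False
    define p where "p = prob (A \<inter> B)"
    have p: "0 < p" using False by (simp add: p_def zero_less_measure_iff)
    have "p \<le> prob A" "p \<le> prob B" unfolding p_def
      using AB sets by (auto intro!: finite_measure_mono)
    then have AB0: "0 < prob A" "0 < prob B" using p by auto
    have "ln (prob A * prob B / p) \<le> prob A * prob B / p - 1"
      using AB0 p by (intro ln_le_minus_one) simp
    then have "p * (ln (prob A) + ln (prob B) - ln p) \<le> p * (prob A * prob B / p - 1)"
      using AB0 p by (intro mult_left_mono) (simp_all add: ln_mult ln_div)
    then show ?thesis using p by (simp add: p_def[symmetric] algebra_simps)
  qed simp
  have "(\<Sum>A\<in>P. \<Sum>B\<in>Q. prob (A \<inter> B) * ln (prob A) + prob (A \<inter> B) * ln (prob B)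
      - prob (A \<inter> B) * ln (prob (A \<inter> B))) \<le> (\<Sum>A\<in>P. \<Sum>B\<in>Q. prob A * prob B - prob (A \<inter> B))"
    by (intro sum_mono gibbs)
  also have "\<dots> = 0"
    using total by (simp add: sum_subtractf marginal_P sum_distrib_left[symmetric])
  finally have le: "(\<Sum>A\<in>P. \<Sum>B\<in>Q. prob (A \<inter> B) * ln (prob A))
      + (\<Sum>A\<in>P. \<Sum>B\<in>Q. prob (A \<inter> B) * ln (prob B))
      - (\<Sum>A\<in>P. \<Sum>B\<in>Q. prob (A \<inter> B) * ln (prob (A \<inter> B))) \<le> 0"
    by (simp add: sum_subtractf sum.distrib)
  have HP: "(\<Sum>A\<in>P. \<Sum>B\<in>Q. prob (A \<inter> B) * ln (prob A)) = (\<Sum>A\<in>P. prob A * ln (prob A))"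
    by (intro sum.cong) (simp_all add: marginal_P sum_distrib_right[symmetric])
  have HQ: "(\<Sum>A\<in>P. \<Sum>B\<in>Q. prob (A \<inter> B) * ln (prob B)) = (\<Sum>B\<in>Q. prob B * ln (prob B))"
    by (subst sum.swap, intro sum.cong) (simp_all add: marginal_Q sum_distrib_right[symmetric])
  have "(\<Sum>C\<in>partition_join P Q. prob C * ln (prob C)) =
    (\<Sum>i\<in>P \<times> Q. prob (case i of (A, B) \<Rightarrow> A \<inter> B) * ln (prob (case i of (A, B) \<Rightarrow> A \<inter> B)))"
    unfolding partition_join_def
  proof (rule sum_nonempty_image)
    fix i j assume "i \<in> P \<times> Q" "j \<in> P \<times> Q" "i \<noteq> j"
    then obtain A B A' B' where ij: "i = (A, B)" "j = (A', B')" "A \<in> P" "B \<in> Q" "A' \<in> P" "B' \<in> Q"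
        and "A \<noteq> A' \<or> B \<noteq> B'"
      by (cases i; cases j) auto
    then have "A \<inter> A' = {} \<or> B \<inter> B' = {}"
      using finite_partition_disjoint[OF P] finite_partition_disjoint[OF Q] by metis
    then show "(case i of (A, B) \<Rightarrow> A \<inter> B) \<inter> (case j of (A, B) \<Rightarrow> A \<inter> B) = {}"
      unfolding ij by auto
  qed (use fin in auto)
  also have "\<dots> = (\<Sum>A\<in>P. \<Sum>B\<in>Q. prob (A \<inter> B) * ln (prob (A \<inter> B)))"
    by (simp add: sum.cartesian_product split_def)
  finally show ?thesis using le HP HQ by (simp add: partition_entropy_def)
qed

lemma entropy_wrt_partition_limit:
  assumes T: "measure_preserving M T" and P: "finite_partition M P"
  shows "(\<lambda>n. partition_entropy M (iterated_join M T P n) / real n)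
    \<longlonglongrightarrow> entropy_wrt_partition M T P"
proof -
  have Tm: "T \<in> measurable M M" using T by (simp add: measure_preserving_def)
  have "convergent (\<lambda>n. partition_entropy M (iterated_join M T P n) / real n)"
  proof (rule subadditive_convergent_average)
    fix m n :: nat assume mn: "0 < m" "0 < n"
    note J = finite_partition_iterated_join[OF P Tm]
    have "partition_entropy M (iterated_join M T P (m + n))
      \<le> partition_entropy M (iterated_join M T P m)
        + partition_entropy M (preimage_partition M (T ^^ m) (iterated_join M T P n))"
      unfolding iterated_join_add[OF P Tm mn]
      by (intro partition_entropy_join_le finite_partition_preimage J measurable_funpow Tm mn)
    then show "partition_entropy M (iterated_join M T P (m + n))
      \<le> partition_entropy M (iterated_join M T P m) + partition_entropy M (iterated_join M T P n)"
      using partition_entropy_preimage[OF measure_preserving_funpow[OF T] J[OF mn(2)]] by simp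
  qed (rule partition_entropy_nonneg)
  then show ?thesis unfolding entropy_wrt_partition_def by (rule convergent_LIMSEQ_iff[THEN iffD1])
qed

text \<open>
  On cells of measure at most \<open>K exp (- s)\<close> the information function is at least \<open>s - ln K\<close>, and the
  remaining cells contribute nonnegatively to the entropy.
\<close>
lemma partition_entropy_ge_small_cells:
  assumes P: "finite_partition M P" and K: "0 < K"
  shows "prob (\<Union>{A\<in>P. prob A \<le> K * exp (- s)}) * (s - ln K) \<le> partition_entropy M P"
proof -
  define R where "R = {A\<in>P. prob A \<le> K * exp (- s)}"
  have R: "finite R" "R \<subseteq> P" "R \<subseteq> events" using P by (auto simp: R_def finite_partition_def)
  have "prob (\<Union>R) = (\<Sum>A\<in>R. prob A)"
    using R finite_partition_disjoint[OF P] finite_measure_finite_Union[of R "\<lambda>A. A"]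
    by (auto simp: disjoint_family_on_def subset_iff)
  then have "prob (\<Union>R) * (s - ln K) = (\<Sum>A\<in>R. prob A * (s - ln K))"
    by (simp add: sum_distrib_right)
  also have "\<dots> \<le> (\<Sum>A\<in>R. - (prob A * ln (prob A)))"
  proof (rule sum_mono)
    fix A assume A: "A \<in> R"
    show "prob A * (s - ln K) \<le> - (prob A * ln (prob A))"
    proof (cases "prob A = 0")
      case False
      then have pos: "0 < prob A" by (simp add: zero_less_measure_iff)
      then have "ln (prob A) \<le> ln (K * exp (- s))" using A by (simp add: R_def)
      then have "s - ln K \<le> - ln (prob A)" using K by (simp add: ln_mult)
      then have "prob A * (s - ln K) \<le> prob A * (- ln (prob A))"
        by (intro mult_left_mono) simp_all
      then show ?thesis by simp
    qed simp
  qed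
  also have "\<dots> \<le> (\<Sum>A\<in>P. - (prob A * ln (prob A)))"
  proof (rule sum_mono2)
    fix A assume "A \<in> P - R"
    show "0 \<le> - (prob A * ln (prob A))"
      using partition_entropy_nonneg[of "{A}"] by (simp add: partition_entropy_def)
  qed (use P R in \<open>auto simp: finite_partition_def\<close>)
  finally show ?thesis by (simp add: R_def partition_entropy_def sum_negf)
qed

text \<open>
  The constant \<open>c\<close> depends on \<open>x\<close>, but it is bounded below by \<open>1 / (k + 1)\<close> on sets whose measure
  tends to \<open>1\<close>, and there a subexponential factor does not affect the rate.  The sets \<open>E k\<close> are
  defined through the cells, rather than through \<open>c\<close>, in order to be measurable.
\<close>
lemma entropy_ge_local_decay_rate:
  assumes T: "measure_preserving M T" and P: "finite_partition M P" and h: "0 \<le> h"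
    and decay: "AE x in M. \<exists>c>0. \<forall>n>0. \<forall>A\<in>iterated_join M T P n.
      x \<in> A \<longrightarrow> c * prob A \<le> exp (- (h * real n))"
  shows "h \<le> entropy_wrt_partition M T P"
proof -
  define J where "J = iterated_join M T P"
  have Tm: "T \<in> measurable M M" using T by (simp add: measure_preserving_def)
  have J: "finite_partition M (J n)" if "0 < n" for n
    unfolding J_def using finite_partition_iterated_join[OF P Tm that] .
  define G where "G k n = \<Union>{A\<in>J n. prob A \<le> real (Suc k) * exp (- (h * real n))}" for k n
  define E where "E k = (\<Inter>n. G k (Suc n))" for k
  have G: "G k n \<in> events" if "0 < n" for k n
    unfolding G_def using J[OF that] by (intro sets.finite_Union) (auto simp: finite_partition_def)
  have E: "E k \<in> events" for k
    unfolding E_def using G by (intro sets.countable_INT) auto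
  have G_mono: "G k n \<subseteq> G l n" if "k \<le> l" for k l n
  proof -
    have "real (Suc k) * exp (- (h * real n)) \<le> real (Suc l) * exp (- (h * real n))"
      using that by (intro mult_right_mono) auto
    then show ?thesis unfolding G_def by (blast intro: order_trans)
  qed
  have "incseq E"
    unfolding E_def by (intro monoI INF_mono') (rule G_mono)
  then have "(\<lambda>k. prob (E k)) \<longlonglongrightarrow> prob (\<Union>k. E k)"
    using E by (intro finite_Lim_measure_incseq) auto
  moreover have "prob (\<Union>k. E k) = 1"
  proof (rule prob_eq_1[THEN iffD2])
    show "AE x in M. x \<in> (\<Union>k. E k)"
      using decay AE_space
    proof eventually_elim
      case (elim x)
      then obtain c where c: "0 < c"
        and small: "\<And>n A. 0 < n \<Longrightarrow> A \<in> J n \<Longrightarrow> x \<in> A \<Longrightarrow> c * prob A \<le> exp (- (h * real n))"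
        unfolding J_def by auto
      obtain k :: nat where k: "1 / c \<le> real k" using real_arch_simple by blast
      have "x \<in> G k (Suc n)" for n
      proof -
        obtain A where A: "A \<in> J (Suc n)" "x \<in> A"
          using J[of "Suc n"] elim(2) by (auto simp: finite_partition_def partition_on_def)
        have "prob A = (1 / c) * (c * prob A)" using c by simp
        also have "\<dots> \<le> real (Suc k) * exp (- (h * real (Suc n)))"
          using small[OF _ A] c k by (intro mult_mono) auto
        finally show ?thesis using A by (auto simp: G_def)
      qed
      then show ?case by (auto simp: E_def)
    qed
  qed (use E in auto)
  ultimately have E_lim: "(\<lambda>k. prob (E k)) \<longlonglongrightarrow> 1" by simp
  have "prob (E k) * h \<le> entropy_wrt_partition M T P" for k
  proof (rule LIMSEQ_le)
    show "(\<lambda>n. partition_entropy M (J n) / real n) \<longlonglongrightarrow> entropy_wrt_partition M T P"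
      unfolding J_def by (rule entropy_wrt_partition_limit[OF T P])
    show "(\<lambda>n. prob (E k) * h - ln (real (Suc k)) / real n) \<longlonglongrightarrow> prob (E k) * h"
      using tendsto_diff[OF tendsto_const lim_const_over_n] by fastforce
    have "prob (E k) * h - ln (real (Suc k)) / real n \<le> partition_entropy M (J n) / real n"
      if n: "0 < n" for n
    proof -
      obtain m where m: "n = Suc m" using n gr0_conv_Suc by blast
      have "E k \<subseteq> G k n" unfolding E_def m by blast
      then have "prob (E k) \<le> prob (G k n)" using G[OF n] by (rule finite_measure_mono)
      then have "prob (E k) * (h * real n) \<le> prob (G k n) * (h * real n)"
        using h by (intro mult_right_mono) auto
      moreover have "prob (G k n) * ln (real (Suc k)) \<le> 1 * ln (real (Suc k))"
        by (intro mult_right_mono) auto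
      moreover have "prob (G k n) * (h * real n - ln (real (Suc k))) \<le> partition_entropy M (J n)"
        unfolding G_def by (rule partition_entropy_ge_small_cells[OF J[OF n]]) simp
      ultimately have "prob (E k) * (h * real n) - ln (real (Suc k)) \<le> partition_entropy M (J n)"
        by (simp add: right_diff_distrib)
      then have "(prob (E k) * (h * real n) - ln (real (Suc k))) / real n
        \<le> partition_entropy M (J n) / real n"
        by (intro divide_right_mono) auto
      then show ?thesis using n by (simp add: diff_divide_distrib)
    qed
    then show "\<exists>N. \<forall>n\<ge>N. prob (E k) * h - ln (real (Suc k)) / real n
        \<le> partition_entropy M (J n) / real n"
      by (intro exI[of _ 1]) auto
  qed
  then show ?thesis
    using LIMSEQ_le_const2[OF tendsto_mult_right[OF E_lim, of h]] by auto
qed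

end

section \<open>Metrics regular with respect to a measure\<close>

lemma finite_partition_subordinate_to_cover:
  assumes U: "finite \<U>" "\<U> \<subseteq> sets M" "\<Union>\<U> = space M"
  shows "\<exists>P. finite_partition M P \<and> (\<forall>A\<in>P. \<exists>B\<in>\<U>. A \<subseteq> B)"
proof -
  obtain f :: "nat \<Rightarrow> 'a set" and n where f: "bij_betw f {0..<n} \<U>"
    using ex_bij_betw_nat_finite[OF U(1)] by blast
  then have img: "f ` {0..<n} = \<U>" by (simp add: bij_betw_def)
  define P where "P = disjointed f ` {0..<n} - {{}}"
  have sets: "disjointed f i \<in> sets M" if "i < n" for i
    unfolding disjointed_def using that img U(2)
    by (intro sets.Diff sets.finite_UN) auto
  have "partition_on (space M) P"
  proof (rule partition_onI)
    have "\<Union>P = (\<Union>i\<in>{0..<n}. disjointed f i)" by (auto simp: P_def)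
    also have "\<dots> = space M" using img U(3) by (simp add: finite_UN_disjointed_eq)
    finally show "\<Union>P = space M" .
    fix p q assume "p \<in> P" "q \<in> P" "p \<noteq> q"
    then obtain i j where "p = disjointed f i" "q = disjointed f j" "i \<noteq> j"
      unfolding P_def by blast
    then show "disjnt p q"
      using less_disjoint_disjointed[of i j f] less_disjoint_disjointed[of j i f]
      by (auto simp: disjnt_def neq_iff)
  qed (simp add: P_def)
  then have "finite_partition M P" using sets by (auto simp: finite_partition_def P_def)
  moreover have "\<exists>B\<in>\<U>. A \<subseteq> B" if "A \<in> P" for A
    using that img disjointed_subset[of f] unfolding P_def by blast
  ultimately show ?thesis by blast
qed

lemma nonatomic_singleton_null:
  assumes M: "nonatomic M" and x: "{x} \<in> sets M"
  shows "emeasure M {x} = 0"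
proof (rule ccontr)
  assume "emeasure M {x} \<noteq> 0"
  then have "0 < emeasure M {x}" by (simp add: zero_less_iff_neq_zero)
  then obtain B where B: "B \<subseteq> {x}" "0 < emeasure M B" "emeasure M B < emeasure M {x}"
    using M x unfolding nonatomic_def by blast
  then have "B = {} \<or> B = {x}" by blast
  then show False using B(2,3) by auto
qed

context
  fixes M :: "'a measure" and d :: "'a \<Rightarrow> 'a \<Rightarrow> real"
  assumes d: "measurable_metric M d"
begin

interpretation Metric_space "space M" d
  using d by (simp add: measurable_metric_def)

lemma borel_measurable_dist:
  assumes "x \<in> space M"
  shows "d x \<in> borel_measurable M"
  using measurable_compose[OF measurable_Pair1'[OF assms], of "\<lambda>(x, y). d x y" M borel] d
  by (simp add: measurable_metric_def)

lemma mball_in_sets: "mball x r \<in> sets M"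
proof (cases "x \<in> space M")
  case True
  then have "mball x r = {y \<in> space M. d x y < r}" by auto
  then show ?thesis using borel_measurable_dist[OF True] by simp
next
  case False
  then have "mball x r = {}" by auto
  then show ?thesis by simp
qed

lemma mcball_in_sets: "mcball x r \<in> sets M"
proof (cases "x \<in> space M")
  case True
  then have "mcball x r = {y \<in> space M. d x y \<le> r}" by auto
  then show ?thesis using borel_measurable_dist[OF True] by simp
next
  case False
  then have "mcball x r = {}" by auto
  then show ?thesis by simp
qed

lemma mcball_radius_zero:
  assumes x: "x \<in> space M"
  shows "mcball x 0 = {x}"
proof -
  have "d x y \<le> 0 \<longleftrightarrow> y = x" if "y \<in> space M" for y
    using zero[OF x that] nonneg[of x y] by (metis order.antisym order.refl)
  then show ?thesis using x by auto
qed

lemma finite_partition_small_diameter: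
  assumes compact: "compact_space mtopology" and \<delta>: "0 < \<delta>"
  obtains P where "finite_partition M P"
    and "\<And>A x y. A \<in> P \<Longrightarrow> x \<in> A \<Longrightarrow> y \<in> A \<Longrightarrow> d x y < \<delta>"
proof -
  define \<B> where "\<B> = (\<lambda>x. mball x (\<delta> / 2)) ` space M"
  have "space M \<subseteq> \<Union>\<B>" using \<delta> by (auto simp: \<B>_def)
  then obtain \<U> where U: "finite \<U>" "\<U> \<subseteq> \<B>" "space M \<subseteq> \<Union>\<U>"
    using compact unfolding compact_space_alt topspace_mtopology
    by (smt (verit) \<B>_def imageE openin_mball)
  have "\<U> \<subseteq> sets M" using U(2) mball_in_sets by (auto simp: \<B>_def)
  moreover have "\<Union>\<U> = space M" using U(2,3) by (auto simp: \<B>_def)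
  ultimately obtain P where P: "finite_partition M P" "\<forall>A\<in>P. \<exists>B\<in>\<U>. A \<subseteq> B"
    using finite_partition_subordinate_to_cover[OF U(1)] by blast
  have "d x y < \<delta>" if "A \<in> P" "x \<in> A" "y \<in> A" for A x y
  proof -
    obtain B where B: "B \<in> \<U>" "A \<subseteq> B" using P(2) \<open>A \<in> P\<close> by auto
    then obtain z where "B = mball z (\<delta> / 2)" using U(2) by (auto simp: \<B>_def)
    then have "x \<in> mball z (\<delta> / 2)" "y \<in> mball z (\<delta> / 2)" using that B(2) by blast+
    then have "x \<in> space M" "y \<in> space M" "z \<in> space M" "d z x < \<delta> / 2" "d z y < \<delta> / 2"
      by simp_all
    then show ?thesis using triangle[of x z y] commute[of x z] by linarith
  qed
  then show ?thesis using P(1) that by blast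
qed

text \<open>
  Regularity at \<open>x\<close> turns a bound on open balls that miss a point of \<open>A\<close> into a bound on \<open>A\<close>
  itself.  Up to a null set \<open>A\<close> lies in the closed ball whose radius \<open>r\<close> is the supremum of the
  distances from \<open>x\<close> to points with small balls.  Measures of open balls are continuous from the
  left in the radius, so the open ball of radius \<open>r\<close> is small as well, although \<open>r\<close> need not be
  attained.
\<close>
lemma measure_le_of_ball_measures_le:
  assumes M: "finite_measure M" and x: "x \<in> space M" and null: "measure M {x} = 0"
    and bounded: "mbounded (space M)"
    and regular: "\<And>r. 0 < r \<Longrightarrow> c * measure M (mcball x r) \<le> measure M (mball x r)"
    and c: "0 < c" and \<rho>: "0 \<le> \<rho>" and A: "A \<in> sets M"
    and balls: "AE y in M. y \<in> A \<longrightarrow> measure M (mball x (d x y)) \<le> \<rho>"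
  shows "c * measure M A \<le> \<rho>"
proof -
  interpret finite_measure M by (fact M)
  define E where "E = {y \<in> space M. measure M (mball x (d x y)) \<le> \<rho>}"
  have A_sub: "AE y in M. y \<in> A \<longrightarrow> y \<in> E"
    using balls sets.sets_into_space[OF A] by (auto simp: E_def elim!: eventually_mono)
  \<comment> \<open>Inserting \<open>x\<close> keeps the set nonempty, so that its supremum is meaningful and at least \<open>0\<close>.\<close>
  define r where "r = (SUP y\<in>insert x E. d x y)"
  obtain D where D: "\<And>y. y \<in> space M \<Longrightarrow> d x y \<le> D"
    using bounded x unfolding mbounded_alt by blast
  have bdd: "bdd_above (d x ` insert x E)"
    using D[of x] D x by (intro bdd_aboveI[of _ D]) (auto simp: E_def)
  have le_r: "d x y \<le> r" if "y \<in> insert x E" for y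
    unfolding r_def using that bdd by (rule cSUP_upper)
  have "0 \<le> r" using le_r[of x] x by simp
  have "E \<subseteq> mcball x r" using le_r x by (auto simp: E_def)
  then have A_le: "measure M A \<le> measure M (mcball x r)"
    using A_sub by (intro finite_measure_mono_AE mcball_in_sets) (auto elim!: eventually_mono)
  show ?thesis
  proof (cases "r = 0")
    \<comment> \<open>Regularity is about positive radii only, so a degenerate ball needs the absence of an atom.\<close>
    case True
    then have "mcball x r = {x}" using mcball_radius_zero[OF x] by simp
    then have "measure M A \<le> 0" using A_le null by simp
    then have "c * measure M A \<le> 0" using c by (simp add: mult_nonneg_nonpos)
    then show ?thesis using \<rho> by linarith
  next
    case False
    then have r: "0 < r" using \<open>0 \<le> r\<close> by simp
    \<comment> \<open>Nonnegative radii strictly below \<open>r\<close> that increase to \<open>r\<close>; each lies below the distance of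
      some point of \<open>E\<close>.\<close>
    define s where "s k = r - r / real (Suc k)" for k
    have s_less: "s k < r" for k using r by (simp add: s_def)
    have s_lim: "s \<longlonglongrightarrow> r"
      unfolding s_def using tendsto_diff[OF tendsto_const LIMSEQ_Suc[OF lim_const_over_n]] by fastforce
    have "incseq s"
      unfolding s_def using r by (intro monoI diff_left_mono divide_left_mono) auto
    then have "incseq (\<lambda>k. mball x (s k))"
      by (intro monoI mball_subset_concentric) (auto dest: incseqD)
    then have "(\<lambda>k. measure M (mball x (s k))) \<longlonglongrightarrow> measure M (\<Union>k. mball x (s k))"
      using mball_in_sets by (intro finite_Lim_measure_incseq) auto
    also have "(\<Union>k. mball x (s k)) = mball x r"
    proof (intro equalityI subsetI)
      fix y assume y: "y \<in> mball x r"
      then have "\<forall>\<^sub>F k in sequentially. d x y < s k" using order_tendstoD(1)[OF s_lim] by simp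
      then obtain k where "d x y < s k" by (auto simp: eventually_sequentially)
      then show "y \<in> (\<Union>k. mball x (s k))" using y by auto
    qed (use s_less in \<open>auto intro: less_trans\<close>)
    finally have lim: "(\<lambda>k. measure M (mball x (s k))) \<longlonglongrightarrow> measure M (mball x r)" .
    have "measure M (mball x (s k)) \<le> \<rho>" for k
    proof -
      obtain y where y: "y \<in> insert x E" "s k < d x y"
        using s_less[of k] less_cSUP_iff[OF _ bdd] unfolding r_def by blast
      have "0 \<le> s k" using r by (simp add: s_def divide_le_eq)
      then have "y \<in> E" using y x by auto
      then have "measure M (mball x (d x y)) \<le> \<rho>" by (simp add: E_def)
      moreover have "measure M (mball x (s k)) \<le> measure M (mball x (d x y))"
        using y(2) by (intro finite_measure_mono mball_in_sets) auto
      ultimately show ?thesis by linarith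
    qed
    then have "measure M (mball x r) \<le> \<rho>"
      by (intro LIMSEQ_le_const2[OF lim]) auto
    moreover have "c * measure M A \<le> c * measure M (mcball x r)"
      using A_le c by (intro mult_left_mono) auto
    ultimately show ?thesis using regular[OF r] by linarith
  qed
qed

end

section \<open>Entropy of restricted pairwise sensitive transformations\<close>

lemma le_exp_of_neg_log:
  assumes a: "0 < a" and p: "0 \<le> p" and le: "ereal t \<le> ereal a * neg_log p"
  shows "p \<le> exp (- (1 / a * t))"
proof (cases "p = 0")
  case False
  then have "t \<le> a * (- ln p)" using le by (simp add: neg_log_def)
  then have "ln p \<le> - (1 / a * t)" using a by (simp add: field_simps)
  then have "exp (ln p) \<le> exp (- (1 / a * t))" by simp
  then show ?thesis using False p by simp
qed simp

theorem corollary3p2: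
  fixes M :: "'a measure" and d :: "'a \<Rightarrow> 'a \<Rightarrow> real" and T :: "'a \<Rightarrow> 'a" and a :: real
  assumes "standard_prob_space M"
    and "measurable_metric M d"
    and "compact_space (Metric_space.mtopology (space M) d)"
    and "nonatomic M"
    and "compatible_metric M d"
    and "regular_metric M d"
    and "measure_preserving M T"
    and "0 < a"
    and "restricted_pairwise_sensitive M d T a"
  shows "ereal (1 / a) \<le> metric_entropy M T"
proof -
  interpret prob_space M using assms(1) by (simp add: standard_prob_space_def)
  interpret Metric_space "space M" d using assms(2) by (simp add: measurable_metric_def)
  interpret pair_sigma_finite M M ..
  have Tm: "T \<in> measurable M M" using assms(7) by (simp add: measure_preserving_def)
  obtain \<delta> where \<delta>: "0 < \<delta>" and "AE (x, y) in M \<Otimes>\<^sub>M M. \<exists>m::nat.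
      ereal (real m) \<le> ereal a * neg_log (prob (mball x (d x y))) \<and>
      d ((T ^^ m) x) ((T ^^ m) y) > \<delta>"
    using assms(9) unfolding restricted_pairwise_sensitive_def by blast
  then have sensitive: "AE x in M. AE y in M. \<exists>m::nat.
      ereal (real m) \<le> ereal a * neg_log (prob (mball x (d x y))) \<and>
      d ((T ^^ m) x) ((T ^^ m) y) > \<delta>"
    using AE_pair by fastforce
  obtain P where P: "finite_partition M P"
    and small: "\<And>A x y. A \<in> P \<Longrightarrow> x \<in> A \<Longrightarrow> y \<in> A \<Longrightarrow> d x y < \<delta>"
    using finite_partition_small_diameter[OF assms(2,3) \<delta>] by blast
  have bounded: "mbounded (space M)"
    using assms(3) compactin_imp_mbounded by (simp add: compact_space_def)
  have "1 / a \<le> entropy_wrt_partition M T P"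
  proof (rule entropy_ge_local_decay_rate[OF assms(7) P])
    show "AE x in M. \<exists>c>0. \<forall>n>0. \<forall>A\<in>iterated_join M T P n.
      x \<in> A \<longrightarrow> c * prob A \<le> exp (- (1 / a * real n))"
      using sensitive AE_space
    proof eventually_elim
      case (elim x)
      then have x: "x \<in> space M" by simp
      have "{x} \<in> events"
        using mcball_radius_zero[OF assms(2) x] mcball_in_sets[OF assms(2), of x 0] by simp
      then have null: "prob {x} = 0"
        using nonatomic_singleton_null[OF assms(4)] by (simp add: measure_def)
      obtain c where c: "0 < c"
        and regular: "\<And>r. 0 < r \<Longrightarrow> c * prob (mcball x r) \<le> prob (mball x r)"
        using assms(6) x unfolding regular_metric_def by blast
      have "c * prob A \<le> exp (- (1 / a * real n))"
        if n: "0 < n" and A: "A \<in> iterated_join M T P n" "x \<in> A" for n A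
      proof (rule measure_le_of_ball_measures_le[OF assms(2) _ x null bounded regular c])
        show "A \<in> events"
          using A finite_partition_iterated_join[OF P Tm n] by (auto simp: finite_partition_def)
        show "AE y in M. y \<in> A \<longrightarrow> prob (mball x (d x y)) \<le> exp (- (1 / a * real n))"
          using elim(1) AE_space
        proof eventually_elim
          case (elim y)
          then obtain m :: nat where
            m: "ereal (real m) \<le> ereal a * neg_log (prob (mball x (d x y)))"
            and far: "\<delta> < d ((T ^^ m) x) ((T ^^ m) y)"
            by blast
          show ?case
          proof
            \<comment> \<open>The orbits are close before time \<open>n\<close>, so they separate no earlier than \<open>n\<close>.\<close>
            assume "y \<in> A"
            then have "same_cell (iterated_join M T P n) x y" using A by (auto simp: same_cell_def)
            then have "same_cell P ((T ^^ i) x) ((T ^^ i) y)" if "i < n" for i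
              using that same_cell_iterated_join[OF x elim(2)] by blast
            then have close: "d ((T ^^ i) x) ((T ^^ i) y) < \<delta>" if "i < n" for i
              using that small unfolding same_cell_def by blast
            then have "n \<le> m" using far by (meson not_less order.asym)
            then have "exp (- (1 / a * real m)) \<le> exp (- (1 / a * real n))"
              using assms(8) by (simp add: divide_right_mono)
            then show "prob (mball x (d x y)) \<le> exp (- (1 / a * real n))"
              using le_exp_of_neg_log[OF assms(8) measure_nonneg m] by linarith
          qed
        qed
      qed (simp_all add: finite_measure_axioms)
      then show ?case using c by blast
    qed
  qed (use assms(8) in simp)
  then have "ereal (1 / a) \<le> ereal (entropy_wrt_partition M T P)" by simp
  also have "\<dots> \<le> metric_entropy M T"
    unfolding metric_entropy_def using P by (intro SUP_upper) simp
  finally show ?thesis .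
qed

end
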